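(* Let $q>2$ be a prime power. For each $n$, let $k=k(n)$ be a positive integer with $k\le \ln(n)$. Choose bases $B_1$ and $B_2$ of the vector space $\mathbb{F}_q^n$ independently and uniformly at random among all bases of $\mathbb{F}_q^n$, and then choose a $k$-element subset $X\subseteq B_1$ uniformly at random. Then the probability that there exists a $k$-element subset $Y\subseteq B_2$ such that $X$ is serially exchangeable with $Y$ (with respect to $B_1,B_2$) tends to $1$ as $n\to\infty$.
   Context: Bases are taken in the matroid on $\mathbb{F}_q^n$ whose independent sets are the linearly independent sets of vectors, so a basis is a linearly independent $n$-element subset of $\mathbb{F}_q^n$. For a basis $B$ and sets $X\subseteq B$, $Y$, write $B-X+Y$ for $(B\setminus X)\cup Y$. For bases $B_1,B_2$ and subsets $X_1\subseteq B_1$, $X_2\subseteq B_2$ with $|X_1|=|X_2|=k$, $X_1$ is serially exchangeable with $X_2$ (with respect to $B_1,B_2$) if there are orderings $x_{11}\prec\cdots\prec x_{1k}$ of $X_1$ and $x_{21}\prec\cdots\prec x_{2k}$ of $X_2$ such that for every $i=1,\dots,k$, both $B_1-\{x_{11},\dots,x_{1i}\}+\{x_{21},\dots,x_{2i}\}$ and $B_2-\{x_{21},\dots,x_{2i}\}+\{x_{11},\dots,x_{1i}\}$ are bases. *)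

theory Defs
  imports
    "HOL-Probability.Probability_Mass_Function"
    "Jordan_Normal_Form.VS_Connect"
begin

hide_type (open) Finite_Cartesian_Product.vec

definition is_basis :: "nat \<Rightarrow> 'a::field vec set \<Rightarrow> bool" where
  "is_basis n B \<longleftrightarrow> B \<subseteq> carrier_vec n \<and> card B = n \<and> finite B \<and>
     \<not> LinearCombinations.module.lin_dep class_ring (module_vec TYPE('a) n) B"

definition bases :: "nat \<Rightarrow> 'a::field vec set set" where
  "bases n = {B. is_basis n B}"

text \<open>The orderings of \<open>X1\<close> and \<open>X2\<close> are the duplicate-free lists \<open>xs\<close> and \<open>ys\<close>.\<close>

definition serially_exchangeable ::
    "nat \<Rightarrow> 'a::field vec set \<Rightarrow> 'a vec set \<Rightarrow> 'a vec set \<Rightarrow> 'a vec set \<Rightarrow> bool" where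
  "serially_exchangeable n B1 B2 X1 X2 \<longleftrightarrow>
     X1 \<subseteq> B1 \<and> X2 \<subseteq> B2 \<and> card X1 = card X2 \<and>
     (\<exists>xs ys. distinct xs \<and> set xs = X1 \<and> distinct ys \<and> set ys = X2 \<and>
        (\<forall>i\<in>{1..card X1}.
           is_basis n ((B1 - set (take i xs)) \<union> set (take i ys)) \<and>
           is_basis n ((B2 - set (take i ys)) \<union> set (take i xs))))"

definition random_bases_subset ::
    "nat \<Rightarrow> nat \<Rightarrow> ('a::{field,finite} vec set \<times> 'a vec set \<times> 'a vec set) pmf" where
  "random_bases_subset n k =
     do {
       B1 \<leftarrow> pmf_of_set (bases n);
       B2 \<leftarrow> pmf_of_set (bases n);
       X \<leftarrow> pmf_of_set {X. X \<subseteq> B1 \<and> card X = k};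
       return_pmf (B1, B2, X)
     }"

text \<open>\<open>pmf_of_set\<close> is only meaningful on finite nonempty sets, which is what it is applied to here
  as long as \<open>k \<le> n\<close>.\<close>

lemma finite_bases: "finite (bases n :: 'a::{field,finite} vec set set)"
proof -
  have "(carrier_vec n :: 'a vec set) \<subseteq> vec_of_list ` {xs. set xs \<subseteq> UNIV \<and> length xs = n}"
  proof
    fix v :: "'a vec" assume "v \<in> carrier_vec n"
    then have "dim_vec v = n" by (rule carrier_vecD)
    then have "length (list_of_vec v) = n" by (simp only: Matrix.length_list_of_vec)
    then have "list_of_vec v \<in> {xs. set xs \<subseteq> UNIV \<and> length xs = n}" by simp
    then show "v \<in> vec_of_list ` {xs. set xs \<subseteq> UNIV \<and> length xs = n}"
      by (rule rev_image_eqI) (rule vec_list[symmetric])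
  qed
  then have "finite (carrier_vec n :: 'a vec set)"
    by (rule finite_subset) (intro finite_imageI finite_lists_length_eq finite)
  then have "finite (Pow (carrier_vec n :: 'a vec set))" by simp
  moreover have "bases n \<subseteq> Pow (carrier_vec n :: 'a vec set)"
    by (auto simp: bases_def is_basis_def)
  ultimately show ?thesis using finite_subset by blast
qed

lemma bases_nonempty: "(bases n :: 'a::field vec set set) \<noteq> {}"
proof -
  interpret vec_space "TYPE('a)" n .
  have "card (set (unit_vecs n :: 'a vec list)) = n"
    using distinct_card[OF unit_vecs_distinct] unit_vecs_length by metis
  moreover have "\<not> lin_dep (set (unit_vecs n))"
    using unit_vecs_basis unfolding basis_def by blast
  ultimately have "is_basis n (set (unit_vecs n) :: 'a vec set)"
    unfolding is_basis_def using unit_vecs_carrier by blast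
  then show ?thesis by (auto simp: bases_def)
qed

lemma finite_subsets_of_basis:
  assumes "B \<in> bases n"
  shows "finite {X. X \<subseteq> B \<and> card X = k}"
  using assms by (auto simp: bases_def is_basis_def)

lemma subsets_of_basis_nonempty:
  assumes "B \<in> bases n" "k \<le> n"
  shows "{X. X \<subseteq> B \<and> card X = k} \<noteq> {}"
  using assms obtain_subset_with_card_n[of k B] by (auto simp: bases_def is_basis_def)

end

theory Submission
  imports Defs "HOL-Combinatorics.Multiset_Permutations" "HOL-Real_Asymp.Real_Asymp"
begin

text \<open>Exchange the elements of \<open>X\<close> greedily, in any order. After the pairs \<open>(S, T)\<close> have been exchanged
  and \<open>x\<close> is to be exchanged next, let \<open>f\<close> be the functional dual to \<open>x\<close> in \<open>(B1 - S) \<union> T\<close>, and let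
  \<open>v\<close> be \<open>x\<close> minus the part supported on \<open>S\<close> of its expansion in \<open>(B2 - T) \<union> S\<close>. Then \<open>f \<noteq> 0\<close> vanishes on
  \<open>B1 - X\<close>, \<open>v \<noteq> 0\<close> lies in the span of \<open>X\<close>, and any \<open>y \<in> B2 - T\<close> with \<open>f y \<noteq> 0\<close> that occurs in the
  expansion of \<open>v\<close> in \<open>B2\<close> can be exchanged for \<open>x\<close>. So the exchange can only get stuck if for one of at most
  \<open>q^(2k)\<close> pairs \<open>(f, v)\<close> the vector \<open>v\<close> is in the span of \<open>B2 \<inter> ker f\<close>. For a fixed pair at most
  \<open>(2q)^n q^((n-1)^2)\<close> ordered bases have this property, while at least half of all \<open>q^(n^2)\<close>
  matrices are nonsingular because \<open>q > 2\<close>. Hence the failure probability is at most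
  \<open>2 q^(2k+1) (2/q)^n\<close>, and \<open>q^(2k)\<close> is polynomially bounded in \<open>n\<close>.\<close>

unbundle no vec_syntax

subsection \<open>Bases in coordinates\<close>

text \<open>Independence is tested coordinatewise, so that all later arguments deal with finite sums
  of field elements only.\<close>

lemma is_basis_iff:
  fixes B :: "'a::field vec set"
  shows "is_basis n B \<longleftrightarrow> B \<subseteq> carrier_vec n \<and> finite B \<and> card B = n \<and>
    (\<forall>a. (\<forall>i<n. (\<Sum>b\<in>B. a b * b $ i) = 0) \<longrightarrow> (\<forall>b\<in>B. a b = 0))"
proof -
  interpret vec_space "TYPE('a)" n .
  have key: "\<not> lin_dep B \<longleftrightarrow> (\<forall>a. (\<forall>i<n. (\<Sum>b\<in>B. a b * b $ i) = 0) \<longrightarrow> (\<forall>b\<in>B. a b = 0))"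
    if B: "B \<subseteq> carrier_vec n" "finite B"
  proof -
    have lc: "lincomb a B = 0\<^sub>v n \<longleftrightarrow> (\<forall>i<n. (\<Sum>b\<in>B. a b * b $ i) = 0)" for a
    proof
      assume "lincomb a B = 0\<^sub>v n"
      then show "\<forall>i<n. (\<Sum>b\<in>B. a b * b $ i) = 0"
        using lincomb_index[OF _ B(1), of _ a] by (metis index_zero_vec(1))
    next
      assume "\<forall>i<n. (\<Sum>b\<in>B. a b * b $ i) = 0"
      then show "lincomb a B = 0\<^sub>v n"
        using lincomb_index[OF _ B(1), of _ a] lincomb_dim[OF B(2,1), of a]
        by (intro eq_vecI) auto
    qed
    show ?thesis
    proof
      assume ind: "\<not> lin_dep B"
      show "\<forall>a. (\<forall>i<n. (\<Sum>b\<in>B. a b * b $ i) = 0) \<longrightarrow> (\<forall>b\<in>B. a b = 0)"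
      proof (intro allI impI ballI, rule ccontr)
        fix a b assume "\<forall>i<n. (\<Sum>b\<in>B. a b * b $ i) = 0" "b \<in> B" "a b \<noteq> 0"
        then have "lin_dep B"
          unfolding lin_dep_def using B lc[of a]
          by (intro exI[of _ B] exI[of _ a] exI[of _ b]) auto
        with ind show False ..
      qed
    next
      assume "\<forall>a. (\<forall>i<n. (\<Sum>b\<in>B. a b * b $ i) = 0) \<longrightarrow> (\<forall>b\<in>B. a b = 0)"
      then have *: "\<forall>b\<in>B. a b = 0" if "lincomb a B = 0\<^sub>v n" for a
        using lc that by blast
      show "\<not> lin_dep B"
        by (rule finite_lin_indpt2[OF B(2) B(1)]) (use * in auto)
    qed
  qed
  show ?thesis
  proof (cases "B \<subseteq> carrier_vec n \<and> finite B")
    case True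
    then show ?thesis using key by (simp add: is_basis_def)
  qed (auto simp: is_basis_def)
qed

lemma is_basisD:
  fixes B :: "'a::field vec set"
  assumes "is_basis n B"
  shows "B \<subseteq> carrier_vec n" "finite B" "card B = n"
    and "\<And>a b. \<lbrakk>\<And>i. i < n \<Longrightarrow> (\<Sum>b\<in>B. a b * b $ i) = 0; b \<in> B\<rbrakk> \<Longrightarrow> a b = 0"
  using assms unfolding is_basis_iff by blast+

definition dot :: "nat \<Rightarrow> (nat \<Rightarrow> 'a::field) \<Rightarrow> 'a vec \<Rightarrow> 'a" where
  "dot n f b = (\<Sum>i<n. f i * b $ i)"

lemma dot_lincomb:
  assumes "\<And>i. i < n \<Longrightarrow> v i = (\<Sum>b\<in>B. c b * b $ i)"
  shows "(\<Sum>i<n. f i * v i) = (\<Sum>b\<in>B. c b * dot n f b)"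
proof -
  have "(\<Sum>i<n. f i * v i) = (\<Sum>i<n. \<Sum>b\<in>B. c b * (f i * b $ i))"
    using assms by (intro sum.cong refl) (simp add: sum_distrib_left mult.left_commute)
  also have "\<dots> = (\<Sum>b\<in>B. c b * dot n f b)"
    by (subst sum.swap) (simp add: dot_def sum_distrib_left)
  finally show ?thesis .
qed

text \<open>Over a finite field an injective linear map between spaces of the same dimension is
  surjective because both have the same number of elements.\<close>

lemma basis_coords:
  fixes B :: "'a::{field,finite} vec set"
  assumes B: "is_basis n B"
  obtains c where "\<And>i. i < n \<Longrightarrow> v i = (\<Sum>b\<in>B. c b * b $ i)"
proof -
  note D = is_basisD[OF B]
  define L where "L c = (\<lambda>i\<in>{..<n}. \<Sum>b\<in>B. c b * b $ i)" for c :: "'a vec \<Rightarrow> 'a"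
  have inj: "inj_on L (B \<rightarrow>\<^sub>E UNIV)"
  proof (rule inj_onI)
    fix c d assume cd: "c \<in> B \<rightarrow>\<^sub>E UNIV" "d \<in> B \<rightarrow>\<^sub>E UNIV" "L c = L d"
    have "(\<Sum>b\<in>B. (c b - d b) * b $ i) = 0" if "i < n" for i
      using fun_cong[OF cd(3), of i] that by (simp add: L_def left_diff_distrib sum_subtractf)
    then have "c b - d b = 0" if "b \<in> B" for b using D(4)[of "\<lambda>b. c b - d b"] that by blast
    then show "c = d" by (intro PiE_ext[OF cd(1,2)]) simp
  qed
  have "L ` (B \<rightarrow>\<^sub>E UNIV) = ({..<n} \<rightarrow>\<^sub>E UNIV)"
  proof (rule card_subset_eq)
    show "card (L ` (B \<rightarrow>\<^sub>E UNIV)) = card ({..<n} \<rightarrow>\<^sub>E (UNIV :: 'a set))"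
      using card_image[OF inj] D(2,3) by (simp add: card_PiE)
  qed (auto simp: L_def finite_PiE split: if_splits)
  then have "restrict v {..<n} \<in> L ` (B \<rightarrow>\<^sub>E UNIV)" by auto
  then obtain c where c: "restrict v {..<n} = L c" by blast
  have "v i = (\<Sum>b\<in>B. c b * b $ i)" if "i < n" for i
    using fun_cong[OF c, of i] that by (simp add: L_def)
  then show thesis by (rule that)
qed

text \<open>Expanding the \<open>i\<close>-th unit vector in \<open>B\<close> writes
  \<open>h i\<close> as a combination of the values \<open>dot n h b\<close> with coefficients that
  do not depend on \<open>h\<close>.\<close>

lemma basis_dot_eq:
  fixes B :: "'a::{field,finite} vec set"
  assumes B: "is_basis n B" and eq: "\<And>b. b \<in> B \<Longrightarrow> dot n f b = dot n g b" and i: "i < n"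
  shows "f i = g i"
proof -
  obtain c where c: "\<And>l. l < n \<Longrightarrow> (if l = i then 1 else 0) = (\<Sum>b\<in>B. c b * b $ l)"
    using basis_coords[OF B, of "\<lambda>l. if l = i then 1 else 0"] by blast
  have *: "h i = (\<Sum>b\<in>B. c b * dot n h b)" for h
    using dot_lincomb[of n "\<lambda>l. if l = i then 1 else 0" c B h, OF c] i
    by (simp add: if_distrib cong: if_cong)
  show ?thesis unfolding *[of f] *[of g] using eq by (intro sum.cong) auto
qed

text \<open>Evaluation on \<open>B\<close> is injective on functionals by
  \<open>basis_dot_eq\<close>, hence surjective, since both sides have q^n elements.\<close>

lemma basis_dual:
  fixes B :: "'a::{field,finite} vec set"
  assumes B: "is_basis n B"
  obtains f where "\<And>b. b \<in> B \<Longrightarrow> dot n f b = (if b = x then 1 else 0)"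
proof -
  note D = is_basisD[OF B]
  define L where "L f = (\<lambda>b\<in>B. dot n f b)" for f
  have inj: "inj_on L ({..<n} \<rightarrow>\<^sub>E UNIV)"
  proof (rule inj_onI)
    fix f g assume fg: "f \<in> {..<n} \<rightarrow>\<^sub>E UNIV" "g \<in> {..<n} \<rightarrow>\<^sub>E UNIV" "L f = L g"
    have "dot n f b = dot n g b" if "b \<in> B" for b
      using fun_cong[OF fg(3), of b] that by (simp add: L_def)
    then have "f i = g i" if "i < n" for i using basis_dot_eq[OF B _ that] by blast
    then show "f = g" by (intro PiE_ext[OF fg(1,2)]) simp
  qed
  have "L ` ({..<n} \<rightarrow>\<^sub>E UNIV) = (B \<rightarrow>\<^sub>E UNIV)"
  proof (rule card_subset_eq)
    show "card (L ` ({..<n} \<rightarrow>\<^sub>E UNIV)) = card (B \<rightarrow>\<^sub>E (UNIV :: 'a set))"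
      using card_image[OF inj] D(2,3) by (simp add: card_PiE)
  qed (auto simp: L_def finite_PiE D(2) split: if_splits)
  then have "(\<lambda>b\<in>B. if b = x then 1 else 0) \<in> L ` ({..<n} \<rightarrow>\<^sub>E UNIV)" by auto
  then obtain f where f: "(\<lambda>b\<in>B. if b = x then 1 else 0) = L f" by blast
  have "dot n f b = (if b = x then 1 else 0)" if "b \<in> B" for b
    using fun_cong[OF f, of b] that by (simp add: L_def)
  then show thesis by (rule that)
qed

text \<open>Applying \<open>f\<close> to a linear relation on the new set leaves only the term of
  \<open>y\<close>, whose coefficient is therefore 0. What remains is a relation inside
  \<open>B\<close>.\<close>

lemma basis_exchange:
  fixes B :: "'a::field vec set"
  assumes B: "is_basis n B" and x: "x \<in> B" and y: "y \<in> carrier_vec n"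
    and f: "\<And>b. b \<in> B - {x} \<Longrightarrow> dot n f b = 0" and fy: "dot n f y \<noteq> 0"
  shows "is_basis n (insert y (B - {x}))"
proof -
  note D = is_basisD[OF B]
  have yB: "y \<notin> B - {x}" using f fy by auto
  have card: "card (insert y (B - {x})) = n"
    using yB x D(2,3) by (metis card.insert card_Suc_Diff1 finite_Diff)
  have indep: "a b = 0" if b: "b \<in> insert y (B - {x})"
    and a: "\<And>i. i < n \<Longrightarrow> (\<Sum>b\<in>insert y (B - {x}). a b * b $ i) = 0" for a b
  proof -
    have "(\<Sum>b\<in>insert y (B - {x}). a b * dot n f b) = 0"
      using dot_lincomb[of n "\<lambda>_. 0" a "insert y (B - {x})" f] a by simp
    moreover have "(\<Sum>b\<in>B - {x}. a b * dot n f b) = 0" using f by (simp add: sum.neutral)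
    ultimately have ay: "a y = 0" using yB D(2) fy by simp
    have "(\<Sum>b\<in>B. (if b = x then 0 else a b) * b $ i) = 0" if "i < n" for i
      using a[OF that] ay yB x D(2) by (simp add: sum.remove)
    then have "(if b = x then 0 else a b) = 0" if "b \<in> B" for b
      using D(4)[of "\<lambda>b. if b = x then 0 else a b"] that by blast
    then show ?thesis using b ay by (metis Diff_iff insert_iff)
  qed
  show ?thesis
    unfolding is_basis_iff
  proof (intro conjI allI impI ballI)
    show "insert y (B - {x}) \<subseteq> carrier_vec n" using D(1) y by auto
    show "finite (insert y (B - {x}))" using D(2) by simp
  qed (use card indep in auto)
qed

subsection \<open>Greedy serial exchange\<close>

text \<open>The vector \<open>v\<close> lies in the span of those elements of \<open>B\<close> on which the functional \<open>f\<close>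
  vanishes.\<close>

definition trapped :: "nat \<Rightarrow> (nat \<Rightarrow> 'a::field) \<Rightarrow> (nat \<Rightarrow> 'a) \<Rightarrow> 'a vec set \<Rightarrow> bool" where
  "trapped n f v B \<longleftrightarrow>
     (\<exists>c. (\<forall>b\<in>B. c b * dot n f b = 0) \<and> (\<forall>i<n. v i = (\<Sum>b\<in>B. c b * b $ i)))"

text \<open>The set depends on \<open>B\<close> and \<open>X\<close> but not on the progress of the
  exchange, which is what makes a union bound possible. Functions are extensional so that they can
  be counted; the same holds for \<open>span_vectors\<close>.\<close>

definition blocking_functionals :: "nat \<Rightarrow> 'a::field vec set \<Rightarrow> 'a vec set \<Rightarrow> (nat \<Rightarrow> 'a) set" where
  "blocking_functionals n B X =
     {f \<in> {..<n} \<rightarrow>\<^sub>E UNIV. (\<exists>i<n. f i \<noteq> 0) \<and> (\<forall>b\<in>B - X. dot n f b = 0)}"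

definition span_vectors :: "nat \<Rightarrow> 'a::field vec set \<Rightarrow> (nat \<Rightarrow> 'a) set" where
  "span_vectors n X = (\<lambda>w. \<lambda>i\<in>{..<n}. \<Sum>x\<in>X. w x * x $ i) ` (X \<rightarrow>\<^sub>E UNIV)
     \<inter> {v. \<exists>i<n. v i \<noteq> 0}"

lemma dot_restrict: "dot n (restrict f {..<n}) b = dot n f b"
  unfolding dot_def by (intro sum.cong) auto

text \<open>\<open>B1\<close> and \<open>B2\<close> may share elements. The cardinality of an
  intermediate basis nevertheless leaves no room for an overlap of its two pieces.\<close>

lemma card_disjoint_if_card_Un:
  assumes "finite B" "S \<subseteq> B" "finite T" "card T = card S" "card ((B - S) \<union> T) = card B"
  shows "(B - S) \<inter> T = {}"
proof -
  have "card (B - S) + card T = card B"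
    using assms card_mono[of B S] by (simp add: card_Diff_subset finite_subset)
  then have "card ((B - S) \<inter> T) = 0"
    using card_Un_Int[of "B - S" T] assms by simp
  then show ?thesis using assms(1) by simp
qed

text \<open>A vector that is not trapped yields one \<open>y\<close> serving both bases:
  \<open>f y \<noteq> 0\<close> lets it replace \<open>x\<close> in the first, and its nonzero
  coefficient in the expansion lets \<open>x\<close> replace it in the second.\<close>

lemma serial_exchange_step:
  fixes B1 B2 :: "'a::{field,finite} vec set"
  assumes B1: "is_basis n B1" and B2: "is_basis n B2" and X: "X \<subseteq> B1"
    and free: "\<And>f v. f \<in> blocking_functionals n B1 X \<Longrightarrow> v \<in> span_vectors n X \<Longrightarrow> \<not> trapped n f v B2"
    and S: "S \<subseteq> X" and T: "T \<subseteq> B2" "card T = card S"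
    and B1': "is_basis n ((B1 - S) \<union> T)" and B2': "is_basis n ((B2 - T) \<union> S)"
    and x: "x \<in> X - S"
  obtains y where "y \<in> B2 - T" "is_basis n ((B1 - insert x S) \<union> insert y T)"
    "is_basis n ((B2 - insert y T) \<union> insert x S)"
proof -
  note D1 = is_basisD[OF B1] and D2 = is_basisD[OF B2]
  have fin: "finite X" "finite S" "finite T"
    using X S T D1(2) D2(2) by (meson finite_subset)+
  have dis1: "(B1 - S) \<inter> T = {}"
    by (rule card_disjoint_if_card_Un[OF D1(2) _ fin(3) T(2)])
      (use S X is_basisD(3)[OF B1'] D1(3) in auto)
  have dis2: "(B2 - T) \<inter> S = {}"
    by (rule card_disjoint_if_card_Un[OF D2(2) T(1) fin(2) T(2)[symmetric]])
      (use is_basisD(3)[OF B2'] D2(3) in auto)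
  obtain f where f: "\<And>b. b \<in> (B1 - S) \<union> T \<Longrightarrow> dot n f b = (if b = x then 1 else 0)"
    using basis_dual[OF B1'] by blast
  obtain c where c: "\<And>i. i < n \<Longrightarrow> x $ i = (\<Sum>b\<in>(B2 - T) \<union> S. c b * b $ i)"
    using basis_coords[OF B2', of "vec_index x"] by blast
  have xB: "x \<in> B1" "x \<notin> T" "x \<in> carrier_vec n" using x X dis1 D1(1) by auto
  \<comment> \<open>These are the coefficients over \<open>X\<close> of \<open>x\<close> minus the
    part on \<open>S\<close> of its expansion, so that \<open>v\<close> is a combination of
    \<open>B2 - T\<close> alone.\<close>
  define w where "w = (\<lambda>b\<in>X. if b = x then 1 else if b \<in> S then - c b else 0)"
  define v where "v = (\<lambda>i\<in>{..<n}. \<Sum>b\<in>X. w b * b $ i)"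
  have v: "v i = (\<Sum>b\<in>B2 - T. c b * b $ i)" if "i < n" for i
  proof -
    have "v i = (\<Sum>b\<in>X. w b * b $ i)" using that by (simp add: v_def)
    also have "\<dots> = (\<Sum>b\<in>insert x S. w b * b $ i)"
      using x S fin by (intro sum.mono_neutral_right) (auto simp: w_def)
    also have "\<dots> = x $ i + (\<Sum>b\<in>S. w b * b $ i)" using x fin by (simp add: w_def)
    also have "(\<Sum>b\<in>S. w b * b $ i) = - (\<Sum>b\<in>S. c b * b $ i)"
      unfolding sum_negf[symmetric] using x S by (intro sum.cong) (auto simp: w_def)
    also have "x $ i = (\<Sum>b\<in>B2 - T. c b * b $ i) + (\<Sum>b\<in>S. c b * b $ i)"
      using c[OF that] dis2 fin D2(2) by (simp add: sum.union_disjoint)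
    finally show ?thesis by simp
  qed
  \<comment> \<open>\<open>X\<close> is independent and \<open>w\<close> has the coefficient 1 at
    \<open>x\<close>.\<close>
  have "\<exists>i<n. v i \<noteq> 0"
  proof (rule ccontr)
    assume "\<not> ?thesis"
    then have z: "(\<Sum>b\<in>X. w b * b $ i) = 0" if "i < n" for i using that by (auto simp: v_def)
    have "(\<Sum>b\<in>B1. (if b \<in> X then w b else 0) * b $ i) = 0" if "i < n" for i
    proof -
      have "(\<Sum>b\<in>B1. (if b \<in> X then w b else 0) * b $ i) = (\<Sum>b\<in>X. w b * b $ i)"
        using X D1(2) by (intro sum.mono_neutral_cong_right) auto
      then show ?thesis using z[OF that] by simp
    qed
    then have "(if x \<in> X then w x else 0) = 0"
      using D1(4)[of "\<lambda>b. if b \<in> X then w b else 0", OF _ xB(1)] by blast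
    then show False using x by (simp add: w_def)
  qed
  moreover have "w \<in> X \<rightarrow>\<^sub>E UNIV" by (simp add: w_def)
  ultimately have vX: "v \<in> span_vectors n X"
    unfolding span_vectors_def v_def by blast
  have "\<exists>i<n. f i \<noteq> 0"
  proof (rule ccontr)
    assume "\<not> ?thesis"
    then have "dot n f x = 0" by (simp add: dot_def)
    then show False using f[of x] xB x by simp
  qed
  moreover have "dot n f b = 0" if "b \<in> B1 - X" for b
  proof -
    have "b \<in> (B1 - S) \<union> T" "b \<noteq> x" using that x S by auto
    then show ?thesis using f[of b] by simp
  qed
  ultimately have "restrict f {..<n} \<in> blocking_functionals n B1 X"
    by (auto simp: blocking_functionals_def dot_restrict)
  from free[OF this vX] have nt: "\<not> trapped n f v B2"
    by (simp add: trapped_def dot_restrict)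
  \<comment> \<open>Extended by 0 on \<open>T\<close>, the coefficients expand \<open>v\<close> in
    all of \<open>B2\<close>. As \<open>v\<close> is not trapped, some \<open>y\<close> has
    \<open>d y\<close> and \<open>f y\<close> both nonzero; the former keeps \<open>y\<close> out of
    \<open>T\<close>.\<close>
  define d where "d b = (if b \<in> T then 0 else c b)" for b
  have "v i = (\<Sum>b\<in>B2. d b * b $ i)" if "i < n" for i
    unfolding v[OF that] d_def using D2(2) by (intro sum.mono_neutral_cong_left) auto
  then obtain y where y: "y \<in> B2" "d y * dot n f y \<noteq> 0"
    using nt unfolding trapped_def by blast
  then have yT: "y \<in> B2 - T" "c y \<noteq> 0" "dot n f y \<noteq> 0" by (auto simp: d_def split: if_splits)
  have yS: "y \<notin> S" "y \<in> carrier_vec n" using dis2 yT D2(1) by auto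
  have "is_basis n (insert y ((B1 - S) \<union> T - {x}))"
    by (rule basis_exchange[OF B1', of _ _ f]) (use f x xB yT yS in auto)
  also have "insert y ((B1 - S) \<union> T - {x}) = (B1 - insert x S) \<union> insert y T"
    using xB by auto
  finally have b1: "is_basis n ((B1 - insert x S) \<union> insert y T)" .
  \<comment> \<open>The functional dual to \<open>y\<close> reads off the coefficient
    \<open>c y\<close> of \<open>x\<close>, so \<open>basis_exchange\<close> applies with the roles
    of \<open>x\<close> and \<open>y\<close> swapped.\<close>
  obtain g where g: "\<And>b. b \<in> (B2 - T) \<union> S \<Longrightarrow> dot n g b = (if b = y then 1 else 0)"
    using basis_dual[OF B2'] by blast
  have "dot n g x = (\<Sum>b\<in>(B2 - T) \<union> S. c b * dot n g b)"
    using dot_lincomb[of n "vec_index x", OF c] by (simp add: dot_def)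
  also have "\<dots> = (\<Sum>b\<in>(B2 - T) \<union> S. if b = y then c b else 0)"
    using g by (intro sum.cong) auto
  also have "\<dots> = c y" using yT D2(2) fin by simp
  finally have gx: "dot n g x \<noteq> 0" using yT by simp
  have "is_basis n (insert x ((B2 - T) \<union> S - {y}))"
    by (rule basis_exchange[OF B2', of _ _ g]) (use g gx yT xB in auto)
  also have "insert x ((B2 - T) \<union> S - {y}) = (B2 - insert y T) \<union> insert x S"
    using yS by auto
  finally show thesis using that[OF yT(1) b1] by blast
qed

text \<open>The greedy step is iterated along an arbitrary enumeration of \<open>X\<close>. The
  induction keeps the claim for all prefixes, and appending a new \<open>y\<close> leaves the
  earlier ones unchanged.\<close>

lemma serially_exchangeable_if_not_trapped:
  fixes B1 B2 :: "'a::{field,finite} vec set"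
  assumes B1: "is_basis n B1" and B2: "is_basis n B2" and X: "X \<subseteq> B1"
    and free: "\<And>f v. f \<in> blocking_functionals n B1 X \<Longrightarrow> v \<in> span_vectors n X \<Longrightarrow> \<not> trapped n f v B2"
  obtains Y where "Y \<subseteq> B2" "card Y = card X" "serially_exchangeable n B1 B2 X Y"
proof -
  have "finite X" using X is_basisD(2)[OF B1] finite_subset by blast
  then obtain xs where xs: "set xs = X" "distinct xs" using finite_distinct_list by blast
  have len: "length xs = card X" using xs distinct_card by fastforce
  have "\<exists>ys. length ys = m \<and> distinct ys \<and> set ys \<subseteq> B2 \<and>
      (\<forall>i\<le>m. is_basis n ((B1 - set (take i xs)) \<union> set (take i ys)) \<and>
             is_basis n ((B2 - set (take i ys)) \<union> set (take i xs)))" if "m \<le> card X" for m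
    using that
  proof (induction m)
    case 0
    then show ?case using B1 B2 by simp
  next
    case (Suc m)
    then obtain ys where ys: "length ys = m" "distinct ys" "set ys \<subseteq> B2"
      and b: "\<And>i. i \<le> m \<Longrightarrow> is_basis n ((B1 - set (take i xs)) \<union> set (take i ys))"
        "\<And>i. i \<le> m \<Longrightarrow> is_basis n ((B2 - set (take i ys)) \<union> set (take i xs))"
      by auto
    have m: "m < length xs" using Suc.prems len by simp
    have tk: "take (Suc m) xs = take m xs @ [xs ! m]" using m by (rule take_Suc_conv_app_nth)
    have "distinct (take (Suc m) xs)" using xs by simp
    then have new: "xs ! m \<in> X - set (take m xs)"
      using xs m unfolding tk by auto
    have c: "card (set ys) = card (set (take m xs))"
      using ys m xs by (simp add: distinct_card)
    obtain y where y: "y \<in> B2 - set ys"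
      "is_basis n ((B1 - insert (xs ! m) (set (take m xs))) \<union> insert y (set ys))"
      "is_basis n ((B2 - insert y (set ys)) \<union> insert (xs ! m) (set (take m xs)))"
      using serial_exchange_step[OF B1 B2 X free _ ys(3) c _ _ new] b[of m] ys(1) xs(1)
      by (metis order_refl set_take_subset take_all)
    have "is_basis n ((B1 - set (take i xs)) \<union> set (take i (ys @ [y]))) \<and>
          is_basis n ((B2 - set (take i (ys @ [y]))) \<union> set (take i xs))" if "i \<le> Suc m" for i
    proof (cases "i = Suc m")
      case True
      then show ?thesis using y ys(1) by (simp add: tk)
    next
      case False
      then show ?thesis using that b[of i] ys(1) by simp
    qed
    then show ?case using ys y by (intro exI[of _ "ys @ [y]"]) auto
  qed
  then obtain ys where ys: "length ys = card X" "distinct ys" "set ys \<subseteq> B2"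
      "\<And>i. i \<le> card X \<Longrightarrow> is_basis n ((B1 - set (take i xs)) \<union> set (take i ys)) \<and>
             is_basis n ((B2 - set (take i ys)) \<union> set (take i xs))"
    by blast
  have c: "card (set ys) = card X" using ys distinct_card by fastforce
  then have "serially_exchangeable n B1 B2 X (set ys)"
    unfolding serially_exchangeable_def using X xs ys
    by (intro conjI exI[of _ xs] exI[of _ ys]) auto
  then show thesis using that ys c by blast
qed

subsection \<open>Counting matrices\<close>

definition matrices :: "nat \<Rightarrow> (nat \<times> nat \<Rightarrow> 'a) set" where
  "matrices n = ({..<n} \<times> {..<n} \<rightarrow>\<^sub>E UNIV)"

lemma card_matrices: "card (matrices n :: (nat \<times> nat \<Rightarrow> 'a::finite) set) = CARD('a) ^ (n * n)"
  by (simp add: matrices_def card_PiE)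

lemma finite_matrices [simp]: "finite (matrices n :: (nat \<times> nat \<Rightarrow> 'a::finite) set)"
  by (simp add: matrices_def finite_PiE)

text \<open>Restriction to \<open>J\<close> is injective on \<open>S\<close>. Solution sets of
  linear systems are thus bounded by counting free entries.\<close>

lemma card_le_if_determined_on:
  fixes S :: "('i \<Rightarrow> 'a::finite) set"
  assumes "finite J" and "\<And>M N. \<lbrakk>M \<in> S; N \<in> S; \<And>j. j \<in> J \<Longrightarrow> M j = N j\<rbrakk> \<Longrightarrow> M = N"
  shows "card S \<le> CARD('a) ^ card J"
proof -
  have "inj_on (\<lambda>M. restrict M J) S"
    by (rule inj_onI) (metis assms(2) restrict_apply')
  then have "card S \<le> card (J \<rightarrow>\<^sub>E (UNIV :: 'a set))"
    by (rule card_inj_on_le) (auto simp: finite_PiE assms)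
  then show ?thesis using assms by (simp add: card_PiE)
qed

lemma sum_determines_entry:
  fixes g h c :: "nat \<Rightarrow> 'a::field"
  assumes "(\<Sum>j<n. g j * c j) = (\<Sum>j<n. h j * c j)" "\<And>j. j < n \<Longrightarrow> j \<noteq> l \<Longrightarrow> g j = h j"
    "l < n" "c l \<noteq> 0"
  shows "g l = h l"
proof -
  have "(\<Sum>j\<in>{..<n} - {l}. g j * c j) = (\<Sum>j\<in>{..<n} - {l}. h j * c j)"
    using assms(2) by (intro sum.cong) auto
  then show ?thesis
    using assms sum.remove[of "{..<n}" l "\<lambda>j. g j * c j"] sum.remove[of "{..<n}" l "\<lambda>j. h j * c j"]
    by simp
qed

lemma card_matrices_image_le:
  fixes c v :: "nat \<Rightarrow> 'a::{field,finite}"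
  assumes l: "l < n" "c l \<noteq> 0"
  shows "card {M \<in> matrices n. \<forall>i<n. (\<Sum>j<n. M (i, j) * c j) = v i} \<le> CARD('a) ^ (n * (n - 1))"
proof -
  let ?J = "{..<n} \<times> ({..<n} - {l})"
  have "card {M \<in> matrices n. \<forall>i<n. (\<Sum>j<n. M (i, j) * c j) = v i} \<le> CARD('a) ^ card ?J"
  proof (rule card_le_if_determined_on)
    fix M N assume M: "M \<in> {M \<in> matrices n. \<forall>i<n. (\<Sum>j<n. M (i, j) * c j) = v i}"
      and N: "N \<in> {M \<in> matrices n. \<forall>i<n. (\<Sum>j<n. M (i, j) * c j) = v i}"
      and eq: "\<And>j. j \<in> ?J \<Longrightarrow> M j = N j"
    have "M (i, l) = N (i, l)" if "i < n" for i
      by (rule sum_determines_entry[of "\<lambda>j. M (i, j)" c n "\<lambda>j. N (i, j)", OF _ _ l])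
        (use M N eq that in auto)
    then have "M (i, j) = N (i, j)" if "i < n" "j < n" for i j
      using eq that by (cases "j = l") auto
    then show "M = N"
      using M N unfolding matrices_def by (intro PiE_ext[of M _ _ N]) auto
  qed simp
  then show ?thesis using l by (simp add: card_cartesian_product)
qed

text \<open>Outside row \<open>m\<close>, the row equations determine column \<open>l\<close>. Then
  each column equation has a single unknown left, its entry in row \<open>m\<close>.\<close>

lemma card_matrices_image_functional_le:
  fixes c v f r :: "nat \<Rightarrow> 'a::{field,finite}"
  assumes l: "l < n" "c l \<noteq> 0" and m: "m < n" "f m \<noteq> 0"
  shows "card {M \<in> matrices n. (\<forall>i<n. (\<Sum>j<n. M (i, j) * c j) = v i) \<and>
      (\<forall>j<n. (\<Sum>i<n. M (i, j) * f i) = r j)} \<le> CARD('a) ^ ((n - 1) * (n - 1))"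
    (is "card ?S \<le> _")
proof -
  let ?J = "({..<n} - {m}) \<times> ({..<n} - {l})"
  have "card ?S \<le> CARD('a) ^ card ?J"
  proof (rule card_le_if_determined_on)
    fix M N assume M: "M \<in> ?S" and N: "N \<in> ?S" and eq: "\<And>j. j \<in> ?J \<Longrightarrow> M j = N j"
    have "M (i, l) = N (i, l)" if "i < n" "i \<noteq> m" for i
      by (rule sum_determines_entry[of "\<lambda>j. M (i, j)" c n "\<lambda>j. N (i, j)", OF _ _ l])
        (use M N eq that in auto)
    then have *: "M (i, j) = N (i, j)" if "i < n" "i \<noteq> m" "j < n" for i j
      using eq that by (cases "j = l") auto
    have "M (m, j) = N (m, j)" if "j < n" for j
      by (rule sum_determines_entry[of "\<lambda>i. M (i, j)" f n "\<lambda>i. N (i, j)", OF _ _ m])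
        (use M N * that in auto)
    then have "M (i, j) = N (i, j)" if "i < n" "j < n" for i j
      using * that by (cases "i = m") auto
    then show "M = N"
      using M N unfolding matrices_def by (intro PiE_ext[of M _ _ N]) auto
  qed simp
  then show ?thesis using l m by (simp add: card_cartesian_product)
qed

section \<open>Singular and nonsingular matrices\<close>

definition nonsingular :: "nat \<Rightarrow> (nat \<times> nat \<Rightarrow> 'a::field) \<Rightarrow> bool" where
  "nonsingular n M \<longleftrightarrow> (\<forall>c. (\<forall>i<n. (\<Sum>j<n. M (i, j) * c j) = 0) \<longrightarrow> (\<forall>j<n. c j = 0))"

text \<open>Each singular matrix kills at least \<open>q - 1\<close> nonzero vectors, the multiples of one of them.\<close>

lemma card_singular_le:
  "(CARD('a) - 1) * card {M \<in> matrices n. \<not> nonsingular n (M :: nat \<times> nat \<Rightarrow> 'a::{field,finite})}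
     \<le> CARD('a) ^ (n * n)"
proof (cases "n = 0")
  case True
  then show ?thesis by (simp add: nonsingular_def)
next
  case False
  define S where "S = {M \<in> matrices n. \<not> nonsingular n (M :: nat \<times> nat \<Rightarrow> 'a)}"
  define C where "C = {c \<in> {..<n} \<rightarrow>\<^sub>E (UNIV :: 'a set). \<exists>j<n. c j \<noteq> 0}"
  define R where "R M c \<longleftrightarrow> (\<forall>i<n. (\<Sum>j<n. M (i, j) * c j) = 0)" for M and c :: "nat \<Rightarrow> 'a"
  have finC: "finite C" by (simp add: C_def finite_PiE)
  have finS: "finite S" by (simp add: S_def)
  have le: "CARD('a) - 1 \<le> card {c \<in> C. R M c}" if "M \<in> S" for M
  proof -
    have "\<not> nonsingular n M" using that by (simp add: S_def)
    then obtain c j where c: "R M c" "j < n" "c j \<noteq> 0"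
      unfolding nonsingular_def R_def by blast
    have "inj_on (\<lambda>t. \<lambda>j\<in>{..<n}. t * c j) (UNIV - {0})"
    proof (rule inj_onI)
      fix s t assume "(\<lambda>j\<in>{..<n}. s * c j) = (\<lambda>j\<in>{..<n}. t * c j)"
      from fun_cong[OF this, of j] have "s * c j = t * c j" using c(2) by simp
      then show "s = t" using c(3) by simp
    qed
    then have "card (UNIV - {0 :: 'a}) \<le> card {c \<in> C. R M c}"
    proof (rule card_inj_on_le)
      have "R M (\<lambda>j\<in>{..<n}. t * c j)" for t
      proof -
        have "(\<Sum>j<n. M (i, j) * (t * c j)) = t * (\<Sum>j<n. M (i, j) * c j)" for i
          by (simp add: sum_distrib_left mult.left_commute)
        then show ?thesis using c(1) by (simp add: R_def)
      qed
      moreover have "(\<lambda>j\<in>{..<n}. t * c j) \<in> C" if "t \<noteq> 0" for t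
        unfolding C_def using c(2,3) that by (intro CollectI conjI exI[of _ j]) auto
      ultimately show "(\<lambda>t. \<lambda>j\<in>{..<n}. t * c j) ` (UNIV - {0}) \<subseteq> {c \<in> C. R M c}"
        by (intro image_subsetI) simp
    qed (use finC in simp)
    then show ?thesis by (simp add: card_Diff_subset)
  qed
  \<comment> \<open>Double counting of the pairs of a singular matrix and a nonzero vector in its
    kernel.\<close>
  have "(CARD('a) - 1) * card S = (\<Sum>M\<in>S. CARD('a) - 1)" by simp
  also have "\<dots> \<le> (\<Sum>M\<in>S. card {c \<in> C. R M c})" by (rule sum_mono) (rule le)
  also have "\<dots> = (\<Sum>c\<in>C. card {M \<in> S. R M c})"
    by (rule sum_multicount_gen[OF finS finC]) simp
  also have "\<dots> \<le> (\<Sum>c\<in>C. CARD('a) ^ (n * (n - 1)))"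
  proof (rule sum_mono)
    fix c assume "c \<in> C"
    then obtain l where l: "l < n" "c l \<noteq> 0" by (auto simp: C_def)
    have "card {M \<in> S. R M c} \<le> card {M \<in> matrices n. \<forall>i<n. (\<Sum>j<n. M (i, j) * c j) = 0}"
      by (rule card_mono) (auto simp: S_def R_def)
    also have "\<dots> \<le> CARD('a) ^ (n * (n - 1))"
      by (rule card_matrices_image_le[of _ _ _ "\<lambda>_. 0"]) (use l in auto)
    finally show "card {M \<in> S. R M c} \<le> CARD('a) ^ (n * (n - 1))" .
  qed
  also have "\<dots> = card C * CARD('a) ^ (n * (n - 1))" by simp
  also have "\<dots> \<le> CARD('a) ^ n * CARD('a) ^ (n * (n - 1))"
  proof (rule mult_right_mono)
    have "card C \<le> card ({..<n} \<rightarrow>\<^sub>E (UNIV :: 'a set))"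
      by (rule card_mono) (auto simp: C_def finite_PiE)
    then show "card C \<le> CARD('a) ^ n" by (simp add: card_PiE)
  qed simp
  also have "\<dots> = CARD('a) ^ (n * n)"
    using False by (cases n) (auto simp: power_add)
  finally show ?thesis unfolding S_def .
qed

text \<open>The singular matrices make up at most a fraction 1/(q-1) of all, and this is at most 1/2
  because q > 2.\<close>

lemma card_nonsingular_ge:
  assumes "2 < CARD('a::{field,finite})"
  shows "CARD('a) ^ (n * n) \<le> 2 * card {M \<in> matrices n. nonsingular n (M :: nat \<times> nat \<Rightarrow> 'a)}"
proof -
  let ?S = "{M \<in> matrices n. \<not> nonsingular n (M :: nat \<times> nat \<Rightarrow> 'a)}"
  let ?N = "{M \<in> matrices n. nonsingular n (M :: nat \<times> nat \<Rightarrow> 'a)}"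
  have "2 * card ?S \<le> (CARD('a) - 1) * card ?S" using assms by (intro mult_right_mono) auto
  also have "\<dots> \<le> CARD('a) ^ (n * n)" by (rule card_singular_le)
  finally have "2 * card ?S \<le> CARD('a) ^ (n * n)" .
  moreover have "card ?S + card ?N = card (?S \<union> ?N)"
    by (rule card_Un_disjoint[symmetric]) auto
  moreover have "?S \<union> ?N = matrices n" by auto
  ultimately show ?thesis by (simp add: card_matrices)
qed

subsection \<open>Counting bases\<close>

text \<open>Ordered bases: each basis of an \<open>n\<close>-dimensional space has
  \<open>fact n\<close> orderings, and an ordered basis is the list of columns of a matrix.\<close>

definition enumerations :: "'a set set \<Rightarrow> 'a list set" where
  "enumerations \<B> = (\<Union>B\<in>\<B>. permutations_of_set B)"

definition matrix_of_list :: "nat \<Rightarrow> 'a vec list \<Rightarrow> nat \<times> nat \<Rightarrow> 'a" where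
  "matrix_of_list n bs = (\<lambda>(i, j)\<in>{..<n} \<times> {..<n}. (bs ! j) $ i)"

lemma card_enumerations:
  fixes \<B> :: "'a::{field,finite} vec set set"
  assumes "\<B> \<subseteq> bases n"
  shows "card (enumerations \<B>) = card \<B> * fact n"
proof -
  have fin: "finite \<B>" using assms finite_bases finite_subset by blast
  have "card (enumerations \<B>) = (\<Sum>B\<in>\<B>. card (permutations_of_set B))"
    unfolding enumerations_def
    by (rule card_UN_disjoint) (use fin in \<open>auto dest: permutations_of_setD\<close>)
  also have "\<dots> = (\<Sum>B\<in>\<B>. fact n)"
    using assms by (intro sum.cong) (auto simp: bases_def is_basis_def)
  finally show ?thesis by simp
qed

lemma enumerationsD:
  assumes "bs \<in> enumerations \<B>" "\<B> \<subseteq> bases n"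
  shows "distinct bs" "length bs = n" "set bs \<in> \<B>" "is_basis n (set bs)"
proof -
  show *: "distinct bs" "set bs \<in> \<B>"
    using assms by (auto simp: enumerations_def permutations_of_set_def)
  then show b: "is_basis n (set bs)" using assms by (auto simp: bases_def)
  show "length bs = n" using distinct_card[OF *(1)] is_basisD(3)[OF b] by simp
qed

lemma finite_enumerations:
  fixes \<B> :: "'a::{field,finite} vec set set"
  assumes "\<B> \<subseteq> bases n"
  shows "finite (enumerations \<B>)"
  using finite_subset[OF assms finite_bases] by (auto simp: enumerations_def)

lemma inj_on_matrix_of_list:
  fixes \<B> :: "'a::{field,finite} vec set set"
  assumes "\<B> \<subseteq> bases n"
  shows "inj_on (matrix_of_list n) (enumerations \<B>)"
proof (rule inj_onI)
  fix bs ds assume bs: "bs \<in> enumerations \<B>" and ds: "ds \<in> enumerations \<B>"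
    and eq: "matrix_of_list n bs = matrix_of_list n ds"
  note b = enumerationsD[OF bs assms] and d = enumerationsD[OF ds assms]
  show "bs = ds"
  proof (rule nth_equalityI)
    fix j assume "j < length bs"
    then have j: "j < n" using b by simp
    then have "bs ! j \<in> carrier_vec n" "ds ! j \<in> carrier_vec n"
      using is_basisD(1)[OF b(4)] is_basisD(1)[OF d(4)] nth_mem[of j bs] nth_mem[of j ds] b(2) d(2)
      by auto
    moreover have "bs ! j $ i = ds ! j $ i" if "i < n" for i
      using fun_cong[OF eq, of "(i, j)"] that j by (simp add: matrix_of_list_def)
    ultimately show "bs ! j = ds ! j" by (intro eq_vecI) auto
  qed (use b d in simp)
qed

lemma sum_enumeration:
  fixes g :: "'b \<Rightarrow> 'c::comm_monoid_add"
  assumes "distinct bs" "length bs = n"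
  shows "(\<Sum>b\<in>set bs. g b) = (\<Sum>j<n. g (bs ! j))"
proof -
  have "bij_betw (\<lambda>j. bs ! j) {..<n} (set bs)" using assms by (intro bij_betw_nth) auto
  then show ?thesis by (rule sum.reindex_bij_betw[symmetric])
qed

text \<open>The columns of a nonsingular matrix form an ordered basis, so the bound on nonsingular
  matrices carries over.\<close>

lemma card_bases_ge:
  assumes "2 < CARD('a::{field,finite})"
  shows "CARD('a) ^ (n * n) \<le> 2 * (card (bases n :: 'a vec set set) * fact n)"
proof -
  let ?N = "{M \<in> matrices n. nonsingular n (M :: nat \<times> nat \<Rightarrow> 'a)}"
  have "?N \<subseteq> matrix_of_list n ` enumerations (bases n)"
  proof
    fix M :: "nat \<times> nat \<Rightarrow> 'a" assume M: "M \<in> ?N"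
    define bs where "bs = map (\<lambda>j. vec n (\<lambda>i. M (i, j))) [0..<n]"
    have len: "length bs = n" by (simp add: bs_def)
    have nth: "bs ! j $ i = M (i, j)" if "i < n" "j < n" for i j
      using that by (simp add: bs_def)
    have carrier: "set bs \<subseteq> carrier_vec n" by (auto simp: bs_def)
    have ns: "\<forall>j<n. c j = 0" if "\<And>i. i < n \<Longrightarrow> (\<Sum>j<n. M (i, j) * c j) = 0" for c
      using M that by (simp add: nonsingular_def)
    have dist: "distinct bs"
      unfolding distinct_conv_nth
    proof (intro allI impI notI)
      fix l m assume lm: "l < length bs" "m < length bs" "l \<noteq> m" "bs ! l = bs ! m"
      \<comment> \<open>Two equal columns would put the difference of two unit vectors into the
        kernel.\<close>
      define c :: "nat \<Rightarrow> 'a" where "c j = (if j = l then 1 else 0) - (if j = m then 1 else 0)" for j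
      have "(\<Sum>j<n. M (i, j) * c j) = 0" if "i < n" for i
      proof -
        have "(\<Sum>j<n. M (i, j) * c j) =
            (\<Sum>j<n. if j = l then M (i, j) else 0) - (\<Sum>j<n. if j = m then M (i, j) else 0)"
          unfolding sum_subtractf[symmetric] by (intro sum.cong) (auto simp: c_def)
        also have "\<dots> = M (i, l) - M (i, m)" using lm len by simp
        finally show ?thesis using nth[of i l] nth[of i m] lm len that by simp
      qed
      then have "\<forall>j<n. c j = 0" by (rule ns)
      then have "c l = 0" using lm len by simp
      then show False using lm by (simp add: c_def)
    qed
    have "a b = 0" if a: "\<And>i. i < n \<Longrightarrow> (\<Sum>b\<in>set bs. a b * b $ i) = 0" and b: "b \<in> set bs" for a b
    proof -
      have "(\<Sum>j<n. M (i, j) * a (bs ! j)) = 0" if "i < n" for i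
        using a[OF that] that nth
        by (simp add: sum_enumeration[OF dist len] mult.commute)
      then have "\<forall>j<n. a (bs ! j) = 0" by (rule ns)
      then show ?thesis using b len by (auto simp: in_set_conv_nth)
    qed
    then have "set bs \<in> bases n"
      unfolding bases_def is_basis_iff using carrier distinct_card[OF dist] len by simp
    then have "bs \<in> enumerations (bases n)"
      using dist by (auto simp: enumerations_def permutations_of_set_def)
    moreover have "M = matrix_of_list n bs"
    proof (rule ext)
      fix p show "M p = matrix_of_list n bs p"
        using M nth by (cases p) (auto simp: matrix_of_list_def matrices_def PiE_def extensional_def)
    qed
    ultimately show "M \<in> matrix_of_list n ` enumerations (bases n)" by blast
  qed
  then have "card ?N \<le> card (enumerations (bases n :: 'a vec set set))"
    by (rule surj_card_le[rotated]) (rule finite_enumerations[OF order_refl])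
  then show ?thesis
    using card_nonsingular_ge[OF assms, of n] card_enumerations[OF order_refl, of n, where 'a='a] by simp
qed

text \<open>If \<open>v\<close> is trapped in the columns of \<open>M\<close> with coefficients \<open>c\<close>, then \<open>c\<close> and the row \<open>r = f M\<close>
  have disjoint supports. There are at most \<open>(2q)^n\<close> such pairs \<open>(c, r)\<close>, and each of them leaves
  only \<open>(n-1)^2\<close> entries of \<open>M\<close> free.\<close>

lemma card_trapped_le:
  fixes f v :: "nat \<Rightarrow> 'a::{field,finite}"
  assumes f: "\<exists>i<n. f i \<noteq> 0" and v: "\<exists>i<n. v i \<noteq> 0"
  shows "card {B \<in> bases n. trapped n f v B} * fact n
      \<le> (2 * CARD('a)) ^ n * CARD('a) ^ ((n - 1) * (n - 1))"
proof -
  define \<B> where "\<B> = {B \<in> bases n. trapped n f v B}"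
  have sub: "\<B> \<subseteq> bases n" by (auto simp: \<B>_def)
  \<comment> \<open>\<open>P\<close> holds the possible pairs of a coefficient and the value of
    \<open>f\<close> at one column. It has 2q-1 elements, estimated by 2q.\<close>
  define P where "P = {p :: 'a \<times> 'a. fst p = 0 \<or> snd p = 0}"
  \<comment> \<open>Nonzero coefficients are built into \<open>S s\<close>, so that the entry count
    bounds it for every \<open>s\<close>. They lose no trapped basis because \<open>v\<close> is
    nonzero.\<close>
  define S where "S s = {M \<in> matrices n. (\<exists>j<n. fst (s j) \<noteq> 0) \<and>
      (\<forall>i<n. (\<Sum>j<n. M (i, j) * fst (s j)) = v i) \<and>
      (\<forall>j<n. (\<Sum>i<n. M (i, j) * f i) = snd (s j))}" for s :: "nat \<Rightarrow> 'a \<times> 'a"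
  have cardS: "card (S s) \<le> CARD('a) ^ ((n - 1) * (n - 1))" for s
  proof (cases "\<exists>j<n. fst (s j) \<noteq> 0")
    case True
    then obtain l where l: "l < n" "fst (s l) \<noteq> 0" by blast
    obtain m where m: "m < n" "f m \<noteq> 0" using f by blast
    show ?thesis
      using card_matrices_image_functional_le[of l n "\<lambda>j. fst (s j)" m f v "\<lambda>j. snd (s j)", OF l m] True
      by (simp add: S_def)
  next
    case False
    then have "S s = {}" by (auto simp: S_def)
    then show ?thesis by simp
  qed
  have "matrix_of_list n ` enumerations \<B> \<subseteq> (\<Union>s\<in>{..<n} \<rightarrow>\<^sub>E P. S s)"
  proof (rule image_subsetI)
    fix bs assume bs: "bs \<in> enumerations \<B>"
    note b = enumerationsD[OF bs sub]
    define M where "M = matrix_of_list n bs"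
    have M: "M (i, j) = bs ! j $ i" if "i < n" "j < n" for i j
      using that by (simp add: M_def matrix_of_list_def)
    obtain c where c: "\<And>b. b \<in> set bs \<Longrightarrow> c b * dot n f b = 0"
      "\<And>i. i < n \<Longrightarrow> v i = (\<Sum>b\<in>set bs. c b * b $ i)"
      using b(3) by (auto simp: \<B>_def trapped_def)
    define s where "s = (\<lambda>j\<in>{..<n}. (c (bs ! j), dot n f (bs ! j)))"
    have "s \<in> {..<n} \<rightarrow>\<^sub>E P" using c(1) b(2) by (auto simp: s_def P_def)
    moreover have "M \<in> S s"
    proof -
      have *: "(\<Sum>j<n. M (i, j) * fst (s j)) = v i" if "i < n" for i
        using c(2)[OF that] that
        by (simp add: M s_def sum_enumeration[OF b(1,2)] mult.commute)
      have "\<exists>j<n. fst (s j) \<noteq> 0"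
      proof (rule ccontr)
        assume "\<not> ?thesis"
        then have "(\<Sum>j<n. M (i, j) * fst (s j)) = 0" for i by simp
        then show False using * v by auto
      qed
      moreover have "(\<Sum>i<n. M (i, j) * f i) = snd (s j)" if "j < n" for j
        using that by (simp add: M s_def dot_def mult.commute)
      moreover have "M \<in> matrices n" by (auto simp: M_def matrix_of_list_def matrices_def)
      ultimately show ?thesis using * by (simp add: S_def)
    qed
    ultimately show "matrix_of_list n bs \<in> (\<Union>s\<in>{..<n} \<rightarrow>\<^sub>E P. S s)" by (auto simp: M_def)
  qed
  then have "card (matrix_of_list n ` enumerations \<B>) \<le> card (\<Union>s\<in>{..<n} \<rightarrow>\<^sub>E P. S s)"
    by (rule card_mono[rotated]) (auto simp: finite_PiE S_def)
  also have "\<dots> \<le> (\<Sum>s\<in>{..<n} \<rightarrow>\<^sub>E P. card (S s))" by (rule card_UN_le) (simp add: finite_PiE)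
  also have "\<dots> \<le> (\<Sum>s\<in>{..<n} \<rightarrow>\<^sub>E P. CARD('a) ^ ((n - 1) * (n - 1)))"
    by (rule sum_mono) (rule cardS)
  also have "\<dots> = card P ^ n * CARD('a) ^ ((n - 1) * (n - 1))" by (simp add: card_PiE)
  also have "\<dots> \<le> (2 * CARD('a)) ^ n * CARD('a) ^ ((n - 1) * (n - 1))"
  proof (intro mult_right_mono power_mono)
    have "P = {0} \<times> UNIV \<union> UNIV \<times> {0}" by (auto simp: P_def)
    then have "card P \<le> card ({0 :: 'a} \<times> (UNIV :: 'a set)) + card ((UNIV :: 'a set) \<times> {0 :: 'a})"
      by (simp only: card_Un_le)
    then show "card P \<le> 2 * CARD('a)" by (simp add: card_cartesian_product)
  qed auto
  finally show ?thesis
    using card_enumerations[OF sub] card_image[OF inj_on_matrix_of_list[OF sub]]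
    by (simp add: \<B>_def)
qed

section \<open>Union bound over the pairs of a functional and a vector\<close>

text \<open>A functional vanishing on \<open>B - X\<close> is determined by its values on
  \<open>X\<close>.\<close>

lemma card_blocking_functionals_le:
  fixes B :: "'a::{field,finite} vec set"
  assumes B: "is_basis n B" and X: "X \<subseteq> B"
  shows "card (blocking_functionals n B X) \<le> CARD('a) ^ card X"
proof -
  have fin: "finite X" using X is_basisD(2)[OF B] finite_subset by blast
  have "inj_on (\<lambda>f. \<lambda>x\<in>X. dot n f x) (blocking_functionals n B X)"
  proof (rule inj_onI)
    fix f g assume f: "f \<in> blocking_functionals n B X" and g: "g \<in> blocking_functionals n B X"
      and eq: "(\<lambda>x\<in>X. dot n f x) = (\<lambda>x\<in>X. dot n g x)"
    have "dot n f b = dot n g b" if "b \<in> B" for b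
      using f g that fun_cong[OF eq, of b]
      by (cases "b \<in> X") (auto simp: blocking_functionals_def)
    then have "f i = g i" if "i < n" for i using basis_dot_eq[OF B _ that] by blast
    moreover have "f \<in> {..<n} \<rightarrow>\<^sub>E UNIV" "g \<in> {..<n} \<rightarrow>\<^sub>E UNIV"
      using f g by (auto simp: blocking_functionals_def)
    ultimately show "f = g" by (intro PiE_ext) auto
  qed
  then have "card (blocking_functionals n B X) \<le> card (X \<rightarrow>\<^sub>E (UNIV :: 'a set))"
    by (rule card_inj_on_le) (auto simp: finite_PiE fin)
  then show ?thesis by (simp add: card_PiE fin)
qed

lemma card_span_vectors_le:
  fixes X :: "'a::{field,finite} vec set"
  assumes "finite X"
  shows "finite (span_vectors n X)" "card (span_vectors n X) \<le> CARD('a) ^ card X"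
proof -
  let ?L = "\<lambda>w :: 'a vec \<Rightarrow> 'a. \<lambda>i\<in>{..<n}. \<Sum>x\<in>X. w x * x $ i"
  have fin: "finite (X \<rightarrow>\<^sub>E (UNIV :: 'a set))" using assms by (simp add: finite_PiE)
  then show "finite (span_vectors n X)" by (simp add: span_vectors_def)
  have "card (span_vectors n X) \<le> card (?L ` (X \<rightarrow>\<^sub>E UNIV))"
    unfolding span_vectors_def using fin by (intro card_mono) auto
  also have "\<dots> \<le> card (X \<rightarrow>\<^sub>E (UNIV :: 'a set))" using fin by (rule card_image_le)
  finally show "card (span_vectors n X) \<le> CARD('a) ^ card X" by (simp add: card_PiE assms)
qed

definition bad_bases :: "nat \<Rightarrow> 'a::field vec set \<Rightarrow> 'a vec set \<Rightarrow> 'a vec set set" where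
  "bad_bases n B X = (\<Union>f\<in>blocking_functionals n B X. \<Union>v\<in>span_vectors n X.
     {B' \<in> bases n. trapped n f v B'})"

text \<open>At most \<open>q ^ k * q ^ k\<close> pairs occur. Comparing the ordered bad bases with
  the lower bound \<open>q ^ (n * n) / 2\<close> for all ordered bases, the factor
  \<open>fact n\<close> cancels.\<close>

lemma card_bad_bases_le:
  fixes B :: "'a::{field,finite} vec set"
  assumes q: "2 < CARD('a)" and n: "0 < n" and B: "is_basis n B" and X: "X \<subseteq> B" "card X = k"
  shows "real (card (bad_bases n B X)) / real (card (bases n :: 'a vec set set))
    \<le> 2 * real CARD('a) * real CARD('a) ^ (2 * k) * (2 / real CARD('a)) ^ n"
proof -
  define q where "q = CARD('a)"
  have q0: "0 < q" by (simp add: q_def)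
  let ?F = "blocking_functionals n B X" and ?V = "span_vectors n X"
  let ?m = "(2 * q) ^ n * q ^ ((n - 1) * (n - 1))"
  have finX: "finite X" using X is_basisD(2)[OF B] finite_subset by blast
  have finF: "finite ?F" by (simp add: blocking_functionals_def finite_PiE)
  have cards: "card ?F \<le> q ^ k" "card ?V \<le> q ^ k" "finite ?V"
    using card_blocking_functionals_le[OF B X(1)] card_span_vectors_le[OF finX] X(2)
    by (auto simp: q_def)
  have "card (bad_bases n B X) \<le> (\<Sum>f\<in>?F. card (\<Union>v\<in>?V. {B' \<in> bases n. trapped n f v B'}))"
    unfolding bad_bases_def by (rule card_UN_le[OF finF])
  also have "\<dots> \<le> (\<Sum>f\<in>?F. \<Sum>v\<in>?V. card {B' \<in> bases n. trapped n f v B'})"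
    by (intro sum_mono card_UN_le cards)
  finally have "card (bad_bases n B X) * fact n
      \<le> (\<Sum>f\<in>?F. \<Sum>v\<in>?V. card {B' \<in> bases n. trapped n f v B'}) * fact n"
    by (rule mult_right_mono) simp
  also have "\<dots> = (\<Sum>f\<in>?F. \<Sum>v\<in>?V. card {B' \<in> bases n. trapped n f v B'} * fact n)"
    by (simp add: sum_distrib_right)
  also have "\<dots> \<le> (\<Sum>f\<in>?F. \<Sum>v\<in>?V. ?m)"
    unfolding q_def
    by (intro sum_mono card_trapped_le) (auto simp: blocking_functionals_def span_vectors_def)
  also have "\<dots> = (card ?F * card ?V) * ?m" by simp
  also have "\<dots> \<le> (q ^ k * q ^ k) * ?m"
    by (intro mult_right_mono mult_mono cards) auto
  finally have bad: "card (bad_bases n B X) * fact n \<le> q ^ (2 * k) * ?m"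
    by (simp add: power_add[symmetric] mult_2)
  have "q ^ (n * n) \<le> 2 * (card (bases n :: 'a vec set set) * fact n)"
    unfolding q_def by (rule card_bases_ge[OF q])
  then have good: "real q ^ (n * n) \<le> 2 * (real (card (bases n :: 'a vec set set)) * fact n)"
    by (metis (mono_tags, lifting) of_nat_fact of_nat_le_iff of_nat_mult of_nat_numeral of_nat_power)
  have pos: "0 < real (card (bases n :: 'a vec set set))"
    by (simp add: card_gt_0_iff finite_bases bases_nonempty)
  have bad': "real (card (bad_bases n B X)) * fact n \<le> real q ^ (2 * k) * real ?m"
    using bad by (metis (mono_tags, lifting) of_nat_fact of_nat_le_iff of_nat_mult of_nat_power)
  \<comment> \<open>From (n-1)^2 = n^2 - 2n + 1. Subtraction is truncated, hence the appeal to
    \<open>n > 0\<close>.\<close>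
  have m: "real ?m = (real q * (2 / real q) ^ n) * real q ^ (n * n)"
  proof -
    obtain p where p: "n = Suc p" using n gr0_implies_Suc by blast
    show ?thesis using q0 unfolding p
      by (simp add: power_mult_distrib power_divide power_add field_simps)
  qed
  have "real (card (bad_bases n B X)) * fact n
      \<le> real q ^ (2 * k) * ((real q * (2 / real q) ^ n) * real q ^ (n * n))"
    using bad' unfolding m .
  also have "\<dots> = (real q ^ (2 * k) * (real q * (2 / real q) ^ n)) * real q ^ (n * n)" by simp
  also have "\<dots> \<le> (real q ^ (2 * k) * (real q * (2 / real q) ^ n)) *
      (2 * (real (card (bases n :: 'a vec set set)) * fact n))"
    by (intro mult_left_mono good) simp
  also have "\<dots> = (2 * real q * real q ^ (2 * k) * (2 / real q) ^ n *
      real (card (bases n :: 'a vec set set))) * fact n"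
    by simp
  finally have "real (card (bad_bases n B X))
      \<le> 2 * real q * real q ^ (2 * k) * (2 / real q) ^ n * real (card (bases n :: 'a vec set set))"
    by (rule mult_right_le_imp_le) simp
  then show ?thesis using pos unfolding q_def by (simp add: divide_le_eq)
qed

lemma serially_exchangeable_if_not_bad:
  fixes B1 B2 :: "'a::{field,finite} vec set"
  assumes "B1 \<in> bases n" "B2 \<in> bases n" "X \<subseteq> B1" "B2 \<notin> bad_bases n B1 X"
  shows "\<exists>Y. Y \<subseteq> B2 \<and> card Y = card X \<and> serially_exchangeable n B1 B2 X Y"
proof -
  have b: "is_basis n B1" "is_basis n B2" using assms by (auto simp: bases_def)
  show ?thesis
    by (rule serially_exchangeable_if_not_trapped[OF b assms(3)])
      (use assms(2,4) in \<open>auto simp: bad_bases_def\<close>)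
qed

subsection \<open>The probability estimate\<close>

text \<open>The probability under \<open>bind_pmf\<close> is the average of the conditional ones, so
  a uniform lower bound on these carries over.\<close>

lemma prob_bind_pmf_ge:
  assumes "\<And>x. x \<in> set_pmf p \<Longrightarrow> c \<le> measure_pmf.prob (f x) A"
  shows "c \<le> measure_pmf.prob (bind_pmf p f) A"
proof -
  have int: "integrable (measure_pmf p) (\<lambda>x. measure_pmf.prob (f x) A)"
    by (rule measure_pmf.integrable_const_bound[where B = 1]) auto
  have "c = measure_pmf.expectation p (\<lambda>_. c)" by simp
  also have "\<dots> \<le> measure_pmf.expectation p (\<lambda>x. measure_pmf.prob (f x) A)"
    using assms by (intro integral_mono_AE int) (auto simp: AE_measure_pmf_iff)
  also have "\<dots> = measure_pmf.prob (bind_pmf p f) A"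
    by (simp add: measure_pmf_bind measure_pmf.measure_bind[where N="count_space UNIV"]
        measure_pmf_in_subprob_algebra)
  finally show ?thesis .
qed

lemma prob_exchangeable_ge:
  assumes q: "2 < CARD('a::{field,finite})" and n: "0 < n" and k: "k \<le> n"
  shows "1 - 2 * real CARD('a) * real CARD('a) ^ (2 * k) * (2 / real CARD('a)) ^ n
    \<le> measure_pmf.prob (random_bases_subset n k)
        {(B1 :: 'a vec set, B2, X). \<exists>Y. Y \<subseteq> B2 \<and> card Y = k \<and> serially_exchangeable n B1 B2 X Y}"
    (is "?c \<le> measure_pmf.prob _ ?A")
proof -
  have fin: "finite (bases n :: 'a vec set set)" "(bases n :: 'a vec set set) \<noteq> {}"
    by (rule finite_bases bases_nonempty)+
  show ?thesis
    unfolding random_bases_subset_def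
  \<comment> \<open>\<open>X\<close> is drawn from \<open>B1\<close> independently of
    \<open>B2\<close>, so the two draws commute. With \<open>B1\<close> and \<open>X\<close> fixed,
    only \<open>B2\<close> is random.\<close>
  proof (rule prob_bind_pmf_ge, subst bind_commute_pmf, rule prob_bind_pmf_ge)
    fix B1 :: "'a vec set" and X
    assume "B1 \<in> set_pmf (pmf_of_set (bases n))"
      and X': "X \<in> set_pmf (pmf_of_set {X. X \<subseteq> B1 \<and> card X = k})"
    then have B1: "B1 \<in> bases n" using fin by simp
    then have X: "X \<subseteq> B1" "card X = k"
      using X' finite_subsets_of_basis[OF B1] subsets_of_basis_nonempty[OF B1 k] by auto
    let ?G = "{B2. (B1, B2, X) \<in> ?A}"
    have "measure_pmf.prob (bind_pmf (pmf_of_set (bases n)) (\<lambda>B2. return_pmf (B1, B2, X))) ?A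
        = measure_pmf.prob (pmf_of_set (bases n)) ?G"
      unfolding map_pmf_def[symmetric] by (simp add: vimage_def)
    also have "\<dots> = real (card (bases n \<inter> ?G)) / real (card (bases n :: 'a vec set set))"
      using fin by (simp add: measure_pmf_of_set)
    also have "\<dots> \<ge> ?c"
    proof -
      have "bases n \<subseteq> (bases n \<inter> ?G) \<union> bad_bases n B1 X"
        using serially_exchangeable_if_not_bad[OF B1 _ X(1)] X(2) by auto
      moreover have "bad_bases n B1 X \<subseteq> bases n" by (auto simp: bad_bases_def)
      ultimately have "card (bases n :: 'a vec set set) \<le> card ((bases n \<inter> ?G) \<union> bad_bases n B1 X)"
        using fin by (intro card_mono) (auto intro: finite_subset)
      also have "\<dots> \<le> card (bases n \<inter> ?G) + card (bad_bases n B1 X)" by (rule card_Un_le)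
      finally have le: "real (card (bases n :: 'a vec set set))
          \<le> real (card (bases n \<inter> ?G)) + real (card (bad_bases n B1 X))"
        by linarith
      have pos: "0 < real (card (bases n :: 'a vec set set))"
        using fin by (simp add: card_gt_0_iff)
      have "1 \<le> real (card (bases n \<inter> ?G)) / real (card (bases n :: 'a vec set set))
          + real (card (bad_bases n B1 X)) / real (card (bases n :: 'a vec set set))"
        using le pos by (simp add: add_divide_distrib[symmetric] le_divide_eq)
      then show ?thesis
        using card_bad_bases_le[OF q n _ X] B1 by (simp add: bases_def)
    qed
    finally show "?c \<le> measure_pmf.prob
        (bind_pmf (pmf_of_set (bases n)) (\<lambda>B2. return_pmf (B1, B2, X))) ?A" .
  qed
qed

text \<open>The condition on \<open>k\<close> starts at \<open>n = 3\<close> because ln n < 1 for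
  the smaller positive n, which admits no positive integer \<open>k n\<close>. The probability is
  squeezed between \<open>1 - e n\<close> and 1.\<close>

theorem theorem1:
  fixes k :: "nat \<Rightarrow> nat"
  assumes "2 < CARD('a::{field,finite})"
    and "\<And>n. 3 \<le> n \<Longrightarrow> 0 < k n \<and> real (k n) \<le> ln (real n)"
  shows "(\<lambda>n. measure_pmf.prob (random_bases_subset n (k n))
            {(B1 :: 'a vec set, B2, X).
               \<exists>Y. Y \<subseteq> B2 \<and> card Y = k n \<and> serially_exchangeable n B1 B2 X Y})
         \<longlonglongrightarrow> 1"
    (is "?p \<longlonglongrightarrow> 1")
proof (rule tendsto_sandwich)
  define q where "q = real CARD('a)"
  have q: "2 < q" using assms(1) by (simp add: q_def)
  \<comment> \<open>From k \<le> ln n one gets q^(2k) \<le> n^(2 ln q), the polynomial factor of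
    this error bound.\<close>
  define e where "e n = 2 * q * (real n powr (2 * ln q) * (2 / q) ^ n)" for n
  have "1 - e n \<le> ?p n" if n: "3 \<le> n" for n
  proof -
    have kn: "real (k n) \<le> ln (real n)" using assms(2)[OF n] by simp
    also have "\<dots> \<le> real n" using n by (simp add: ln_le_minus_one[THEN order_trans])
    finally have "k n \<le> n" by simp
    have "q ^ (2 * k n) = exp (2 * ln q * real (k n))"
      using q by (simp add: powr_realpow[symmetric] powr_def mult_ac)
    also have "\<dots> \<le> exp (2 * ln q * ln (real n))"
      using kn q by simp
    also have "\<dots> = real n powr (2 * ln q)" using n by (simp add: powr_def)
    finally have "2 * q * q ^ (2 * k n) * (2 / q) ^ n \<le> e n"
      unfolding e_def mult.assoc using q by (intro mult_left_mono mult_right_mono) auto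
    then show ?thesis
      using prob_exchangeable_ge[OF assms(1) _ \<open>k n \<le> n\<close>] n unfolding q_def by force
  qed
  then show "\<forall>\<^sub>F n in sequentially. 1 - e n \<le> ?p n"
    by (auto simp: eventually_sequentially)
  \<comment> \<open>Here q > 2 enters a second time: the geometric decay with ratio 2/q beats any
    power of n.\<close>
  have "0 < 2 / q" "2 / q < 1" using q by auto
  then have "(\<lambda>n. real n powr (2 * ln q) * (2 / q) ^ n) \<longlonglongrightarrow> 0"
    using q by real_asymp
  then have "e \<longlonglongrightarrow> 2 * q * 0" unfolding e_def by (rule tendsto_mult_left)
  then have "(\<lambda>n. 1 - e n) \<longlonglongrightarrow> 1 - 2 * q * 0" by (intro tendsto_diff tendsto_const)
  then show "(\<lambda>n. 1 - e n) \<longlonglongrightarrow> 1" by simp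
qed auto

end
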